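(* There exist an integer $n$ and a graph $G$ on vertices $v_0,v_1,\ldots,v_{n-1}$ such that $\{v_i,v_{i+1}\}$ is an edge of $G$ for every $i\in\{0,\ldots,n-2\}$, $G$ is persistent (it satisfies both the X-property and the Bar-property), and there is no terrain $T$ with points $p_0,\ldots,p_{n-1}$ such that $G$ is the visibility graph of $T$ (with $v_i$ corresponding to $p_i$ for every $i$).
   Context: A terrain $T$ is an $x$-monotone polygonal chain in the plane with vertices (points) $p_0,p_1,\ldots,p_{n-1}$ listed from left to right, so the $x$-coordinates satisfy $p_0^x<p_1^x<\cdots<p_{n-1}^x$, and consecutive points are joined by segments. Two points $p_i,p_j$ ($i<j$) see each other iff the open segment $\overline{p_ip_j}$ lies strictly above $T$; equivalently, $j=i+1$ or every $p_k$ with $i<k<j$ lies strictly below the segment $\overline{p_ip_j}$. The visibility graph of $T$ has a vertex $v_i$ for each point $p_i$, and $\{v_i,v_j\}$ is an edge iff $p_i$ and $p_j$ see each other. For a graph $G$ on labeled vertices $v_0,\ldots,v_{n-1}$ in which each $\{v_i,v_{i+1}\}$ is an edge: the X-property says that for all $0\le a<b<c<d\le n-1$, if $\{v_a,v_c\}$ and $\{v_b,v_d\}$ are edges then $\{v_a,v_d\}$ is an edge; the Bar-property says that for every edge $\{v_i,v_k\}$ with $k\ge i+2$ there is $j$ with $i<j<k$ such that $\{v_i,v_j\}$ and $\{v_j,v_k\}$ are both edges. $G$ is persistent iff it satisfies both properties. *)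

theory Defs
  imports Main "HOL.Real"
begin

definition is_graph :: "nat \<Rightarrow> (nat \<Rightarrow> nat \<Rightarrow> bool) \<Rightarrow> bool" where
  "is_graph n E \<longleftrightarrow> (\<forall>i j. E i j \<longrightarrow> E j i) \<and> (\<forall>i. \<not> E i i)
     \<and> (\<forall>i j. E i j \<longrightarrow> i < n \<and> j < n)"

definition X_property :: "nat \<Rightarrow> (nat \<Rightarrow> nat \<Rightarrow> bool) \<Rightarrow> bool" where
  "X_property n E \<longleftrightarrow> (\<forall>a b c d. a < b \<and> b < c \<and> c < d \<and> d < n
      \<and> E a c \<and> E b d \<longrightarrow> E a d)"

definition Bar_property :: "nat \<Rightarrow> (nat \<Rightarrow> nat \<Rightarrow> bool) \<Rightarrow> bool" where
  "Bar_property n E \<longleftrightarrow> (\<forall>i k. i + 2 \<le> k \<and> k < n \<and> E i k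
      \<longrightarrow> (\<exists>j. i < j \<and> j < k \<and> E i j \<and> E j k))"

definition persistent :: "nat \<Rightarrow> (nat \<Rightarrow> nat \<Rightarrow> bool) \<Rightarrow> bool" where
  "persistent n E \<longleftrightarrow> X_property n E \<and> Bar_property n E"

definition is_terrain :: "nat \<Rightarrow> (nat \<Rightarrow> real \<times> real) \<Rightarrow> bool" where
  "is_terrain n p \<longleftrightarrow> (\<forall>i j. i < j \<and> j < n \<longrightarrow> fst (p i) < fst (p j))"

definition strictly_below :: "(nat \<Rightarrow> real \<times> real) \<Rightarrow> nat \<Rightarrow> nat \<Rightarrow> nat \<Rightarrow> bool" where
  "strictly_below p i j k \<longleftrightarrow>
     snd (p k) < snd (p i) + (snd (p j) - snd (p i)) / (fst (p j) - fst (p i)) * (fst (p k) - fst (p i))"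

definition sees :: "(nat \<Rightarrow> real \<times> real) \<Rightarrow> nat \<Rightarrow> nat \<Rightarrow> bool" where
  "sees p i j \<longleftrightarrow> j = i + 1 \<or> (\<forall>k. i < k \<and> k < j \<longrightarrow> strictly_below p i j k)"

definition is_visibility_graph :: "nat \<Rightarrow> (nat \<Rightarrow> real \<times> real) \<Rightarrow> (nat \<Rightarrow> nat \<Rightarrow> bool) \<Rightarrow> bool" where
  "is_visibility_graph n p E \<longleftrightarrow> (\<forall>i j. i < j \<and> j < n \<longrightarrow> (E i j \<longleftrightarrow> sees p i j))"

end

theory Submission
  imports Defs
begin

text \<open>
  The graph has fifteen vertices: a left wall \<open>0..6\<close>, the bottom \<open>7\<close> of a valley, and a right wall
  \<open>8..14\<close>. The bottom sees everything, and both walls carry the same graph on seven vertices.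

  Place the bottom at the origin. The projective map \<open>(x, y) \<mapsto> (y / x, 1 / \<bar>x\<bar>)\<close> turns each wall into a
  terrain with the same visibilities in which the slope seen from the bottom is the new abscissa.
  The graph of a wall forces a strict inequality between two products of gaps of these abscissae.
  The visibilities across the valley determine how the slopes of the two walls interleave, and
  the interleaving is chosen such that the product of the two inequalities fails.
\<close>

section \<open>Orientation and visibility\<close>

text \<open>The slope comparison of \<open>strictly_below\<close> with the denominator cleared. The
  coordinates are separate functions so that it also applies to transformed ones.\<close>

definition below :: "(nat \<Rightarrow> real) \<Rightarrow> (nat \<Rightarrow> real) \<Rightarrow> nat \<Rightarrow> nat \<Rightarrow> nat \<Rightarrow> bool" where
  "below x y i j k \<longleftrightarrow> (x j - x i) * (y k - y i) < (y j - y i) * (x k - x i)"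

lemma strictly_below_iff_below:
  assumes "fst (p i) < fst (p j)"
  shows "strictly_below p i j k \<longleftrightarrow> below (\<lambda>v. fst (p v)) (\<lambda>v. snd (p v)) i j k"
  using assms by (simp add: strictly_below_def below_def field_simps)

text \<open>Seen from \<open>i\<close>, the slope to \<open>k\<close> exceeds the slope to
  \<open>l\<close>, which is at least the slope to \<open>j\<close>.\<close>

lemma below_trans:
  assumes x: "x i < x l" "x l < x k" "x k < x j"
    and lk: "below x y i k l" and lj: "\<not> below x y i j l"
  shows "\<not> below x y i j k"
proof
  assume kj: "below x y i j k"
  define J K L where "J = x j - x i" and "K = x k - x i" and "L = x l - x i"
  have pos: "J > 0" "K > 0" "L > 0"
    using x by (simp_all add: J_def K_def L_def)
  have "K * (J * (y l - y i)) = J * (K * (y l - y i))"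
    by (rule mult.left_commute)
  also have "\<dots> < J * ((y k - y i) * L)"
    using lk pos by (intro mult_strict_left_mono) (simp_all add: below_def K_def L_def)
  also have "\<dots> = (J * (y k - y i)) * L"
    by (rule mult.assoc[symmetric])
  also have "\<dots> < ((y j - y i) * K) * L"
    using kj pos by (intro mult_strict_right_mono) (simp_all add: below_def J_def K_def)
  also have "\<dots> = K * ((y j - y i) * L)"
    by (simp only: mult_ac)
  finally have "J * (y l - y i) < (y j - y i) * L"
    using pos by (simp only: mult_less_cancel_left_pos)
  with lj show False
    by (simp add: below_def J_def L_def)
qed

lemma below_reflect: "below (\<lambda>v. - x v) y j i k \<longleftrightarrow> below x y i j k"
  by (simp add: below_def algebra_simps)

locale terrain_drawing =
  fixes n :: nat and p :: "nat \<Rightarrow> real \<times> real" and E :: "nat \<Rightarrow> nat \<Rightarrow> bool"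
  assumes terrain: "is_terrain n p" and visibility: "is_visibility_graph n p E"
begin

abbreviation "px v \<equiv> fst (p v)"
abbreviation "py v \<equiv> snd (p v)"

lemma px_less: "i < j \<Longrightarrow> j < n \<Longrightarrow> px i < px j"
  using terrain by (simp add: is_terrain_def)

lemma edge_iff_below:
  assumes "i < j" "j < n"
  shows "E i j \<longleftrightarrow> (\<forall>k. i < k \<and> k < j \<longrightarrow> below px py i j k)"
  using assms visibility px_less[OF assms]
  by (auto simp: is_visibility_graph_def sees_def strictly_below_iff_below)

lemma edge_below:
  assumes "E i j" "i < k" "k < j" "j < n"
  shows "below px py i j k"
  using assms edge_iff_below[of i j] by simp

text \<open>If another vertex \<open>l\<close> blocks the segment, it lies below the segment from \<open>k\<close> to one of the
  ends, so \<open>k\<close> blocks as well.\<close>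

lemma common_neighbour_blocks:
  assumes "\<not> E i j" "E i k" "E k j" "i < k" "k < j" "j < n"
  shows "\<not> below px py i j k"
proof -
  obtain l where l: "i < l" "l < j" "\<not> below px py i j l"
    using assms edge_iff_below[of i j] by auto
  consider "l = k" | "l < k" | "k < l" by linarith
  then show ?thesis
  proof cases
    case 1
    then show ?thesis using l by simp
  next
    case 2
    then show ?thesis
      using below_trans[of px i l k j py] l assms edge_below[of i k l] px_less by auto
  next
    case 3
    then show ?thesis
      using below_trans[of "\<lambda>v. - px v" j l k i py] l assms edge_below[of k j l] px_less
      by (auto simp: below_reflect)
  qed
qed

end

section \<open>The view from the bottom of the valley\<close>

definition slope_from :: "real \<times> real \<Rightarrow> real \<times> real \<Rightarrow> real" where
  "slope_from c q = (snd q - snd c) / (fst q - fst c)"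

definition nearness :: "real \<times> real \<Rightarrow> real \<times> real \<Rightarrow> real" where
  "nearness c q = 1 / \<bar>fst q - fst c\<bar>"

text \<open>The orientation determinant of the images is the original one divided by the positive
  product of the three horizontal distances to \<open>c\<close>.\<close>

lemma below_projective:
  fixes q :: "nat \<Rightarrow> real \<times> real"
  assumes "(fst (q i) < fst c \<and> fst (q j) < fst c \<and> fst (q k) < fst c)
    \<or> (fst c < fst (q i) \<and> fst c < fst (q j) \<and> fst c < fst (q k))"
  shows "below (\<lambda>v. slope_from c (q v)) (\<lambda>v. nearness c (q v)) i j k
    \<longleftrightarrow> below (\<lambda>v. fst (q v)) (\<lambda>v. snd (q v)) i j k"
proof -
  define X Y where "X v = fst (q v) - fst c" and "Y v = snd (q v) - snd c" for v
  define W where "W = \<bar>X i\<bar> * \<bar>X j\<bar> * \<bar>X k\<bar>"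
  have nz: "X i \<noteq> 0" "X j \<noteq> 0" "X k \<noteq> 0" and W: "W > 0"
    using assms by (auto simp: X_def W_def)
  have "W * ((Y j / X j - Y i / X i) * (1 / \<bar>X k\<bar> - 1 / \<bar>X i\<bar>)
        - (1 / \<bar>X j\<bar> - 1 / \<bar>X i\<bar>) * (Y k / X k - Y i / X i))
      = (X j - X i) * (Y k - Y i) - (Y j - Y i) * (X k - X i)"
    (is "W * ?D = _")
  proof -
    consider "X i < 0" "X j < 0" "X k < 0" | "X i > 0" "X j > 0" "X k > 0"
      using assms by (auto simp: X_def)
    then show ?thesis
      by cases (simp_all add: W_def field_simps)
  qed
  then have "?D < 0 \<longleftrightarrow> (X j - X i) * (Y k - Y i) - (Y j - Y i) * (X k - X i) < 0"
    using W by (metis mult_less_0_iff not_less_iff_gr_or_eq)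
  then show ?thesis
    by (simp add: below_def slope_from_def nearness_def X_def Y_def)
qed

lemma slope_from_left_less_iff:
  fixes q :: "nat \<Rightarrow> real \<times> real"
  assumes "fst (q i) < fst (q k)" "fst (q k) < fst (q c)"
  shows "slope_from (q c) (q i) < slope_from (q c) (q k)
    \<longleftrightarrow> below (\<lambda>v. fst (q v)) (\<lambda>v. snd (q v)) i c k"
  using assms
  by (simp add: slope_from_def below_def divide_simps) (auto simp: algebra_simps)

lemma slope_from_right_less_iff:
  fixes q :: "nat \<Rightarrow> real \<times> real"
  assumes "fst (q c) < fst (q k)" "fst (q k) < fst (q j)"
  shows "slope_from (q c) (q k) < slope_from (q c) (q j)
    \<longleftrightarrow> below (\<lambda>v. fst (q v)) (\<lambda>v. snd (q v)) c j k"
  using assms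
  by (simp add: slope_from_def below_def divide_simps) (auto simp: algebra_simps)

lemma slope_from_across_less_iff:
  fixes q :: "nat \<Rightarrow> real \<times> real"
  assumes "fst (q i) < fst (q c)" "fst (q c) < fst (q j)"
  shows "slope_from (q c) (q i) < slope_from (q c) (q j)
    \<longleftrightarrow> below (\<lambda>v. fst (q v)) (\<lambda>v. snd (q v)) i j c"
  using assms
  by (simp add: slope_from_def below_def divide_simps) (auto simp: algebra_simps)

section \<open>The inequality forced by one wall\<close>

text \<open>The premises bound ratios of the heights of 0, 2, 6, 4 over the line through 1 and 3.
  Multiplied around this cycle, the heights cancel.\<close>

lemma wall_inequality:
  fixes t e :: "nat \<Rightarrow> real"
  assumes t: "t 0 < t 1" "t 1 < t 2" "t 2 < t 3" "t 3 < t 4" "t 4 < t 5" "t 5 < t 6"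
    and "\<not> below t e 0 2 1" "\<not> below t e 4 6 5" "\<not> below t e 1 5 3"
    and "below t e 0 4 3" "below t e 2 6 3" "below t e 0 3 1"
  shows "(t 2 - t 1) * (t 3 - t 0) * (t 5 - t 4) * (t 6 - t 3)
    < (t 1 - t 0) * (t 3 - t 2) * (t 4 - t 3) * (t 6 - t 5)"
proof -
  define z where "z i = (e i - e 1) * (t 3 - t 1) - (e 3 - e 1) * (t i - t 1)" for i
  \<comment> \<open>\<open>z\<close> is a positive multiple of the height above the line through the vertices 1 and 3.\<close>
  have z13: "z 1 = 0" "z 3 = 0"
    by (simp_all add: z_def)
  \<comment> \<open>Subtracting an affine function of \<open>t\<close> and scaling by
    \<open>t 3 - t 1 > 0\<close> preserves \<open>below\<close>.\<close>
  have below_z: "below t e i j k \<longleftrightarrow> z k * (t j - t i) < z i * (t j - t k) + z j * (t k - t i)"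
    for i j k
  proof -
    have "z i * (t j - t k) + z j * (t k - t i) - z k * (t j - t i)
      = (t 3 - t 1) * ((e j - e i) * (t k - t i) - (t j - t i) * (e k - e i))"
      unfolding z_def by (simp add: algebra_simps)
    then show ?thesis
      using t by (simp add: below_def) (smt (verit) zero_less_mult_iff mult_pos_pos)
  qed
  have z0: "z 0 > 0"
    using assms z13 by (simp add: below_z zero_less_mult_iff)
  have z5: "z 5 \<le> 0"
    using assms z13 by (simp add: below_z not_less mult_le_0_iff)
  have a1: "z 0 * (t 2 - t 1) \<le> - z 2 * (t 1 - t 0)"
    using assms z13 by (simp add: below_z)
  have a2: "- z 2 * (t 6 - t 3) < z 6 * (t 3 - t 2)"
    using assms z13 by (simp add: below_z)
  have a3: "z 6 * (t 5 - t 4) \<le> - z 4 * (t 6 - t 5)"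
  proof -
    have "z 4 * (t 6 - t 5) + z 6 * (t 5 - t 4) \<le> z 5 * (t 6 - t 4)"
      using assms by (simp add: below_z)
    also have "\<dots> \<le> 0"
      using z5 t by (simp add: mult_le_0_iff)
    finally show ?thesis by simp
  qed
  have a4: "- z 4 * (t 3 - t 0) < z 0 * (t 4 - t 3)"
    using assms z13 by (simp add: below_z)
  have "z 0 * ((t 2 - t 1) * (t 3 - t 0) * (t 5 - t 4) * (t 6 - t 3))
      = (z 0 * (t 2 - t 1)) * ((t 3 - t 0) * (t 5 - t 4) * (t 6 - t 3))"
    by simp
  also have "\<dots> \<le> (- z 2 * (t 1 - t 0)) * ((t 3 - t 0) * (t 5 - t 4) * (t 6 - t 3))"
    using a1 t by (intro mult_right_mono) auto
  also have "\<dots> = (- z 2 * (t 6 - t 3)) * ((t 1 - t 0) * (t 3 - t 0) * (t 5 - t 4))"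
    by simp
  also have "\<dots> < (z 6 * (t 3 - t 2)) * ((t 1 - t 0) * (t 3 - t 0) * (t 5 - t 4))"
    using a2 t by (intro mult_strict_right_mono) auto
  also have "\<dots> = (z 6 * (t 5 - t 4)) * ((t 1 - t 0) * (t 3 - t 0) * (t 3 - t 2))"
    by simp
  also have "\<dots> \<le> (- z 4 * (t 6 - t 5)) * ((t 1 - t 0) * (t 3 - t 0) * (t 3 - t 2))"
    using a3 t by (intro mult_right_mono) auto
  also have "\<dots> = (- z 4 * (t 3 - t 0)) * ((t 1 - t 0) * (t 6 - t 5) * (t 3 - t 2))"
    by simp
  also have "\<dots> < (z 0 * (t 4 - t 3)) * ((t 1 - t 0) * (t 6 - t 5) * (t 3 - t 2))"
    using a4 t by (intro mult_strict_right_mono) auto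
  also have "\<dots> = z 0 * ((t 1 - t 0) * (t 3 - t 2) * (t 4 - t 3) * (t 6 - t 5))"
    by simp
  finally show ?thesis
    using z0 by (simp add: mult_less_cancel_left)
qed

text \<open>Each gap on a larger side lies inside a gap on a smaller side: \<open>[v 0, v 1]\<close>
  in \<open>[u 1, u 2]\<close>, \<open>[u 0, u 1]\<close> in \<open>[u 0, u 3]\<close>, and so on.
  So the product of the smaller sides is at least that of the larger ones.\<close>

lemma interleaved_walls_contradiction:
  fixes u v :: "nat \<Rightarrow> real"
  assumes wu: "(u 2 - u 1) * (u 3 - u 0) * (u 5 - u 4) * (u 6 - u 3)
      < (u 1 - u 0) * (u 3 - u 2) * (u 4 - u 3) * (u 6 - u 5)"
    and wv: "(v 2 - v 1) * (v 3 - v 0) * (v 5 - v 4) * (v 6 - v 3)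
      < (v 1 - v 0) * (v 3 - v 2) * (v 4 - v 3) * (v 6 - v 5)"
    and u: "u 0 < u 1" "u 1 < u 2" "u 2 < u 3" "u 3 < u 4" "u 4 < u 5" "u 5 < u 6"
    and v: "v 0 < v 1" "v 1 < v 2" "v 2 < v 3" "v 3 < v 4" "v 4 < v 5" "v 5 < v 6"
    and uv: "u 1 \<le> v 0" "v 1 \<le> u 2" "u 3 \<le> v 2" "u 4 \<le> v 3" "v 4 \<le> u 5" "u 6 \<le> v 5"
  shows False
proof -
  have "((u 1 - u 0) * (u 3 - u 2) * (u 4 - u 3) * (u 6 - u 5))
      * ((v 1 - v 0) * (v 3 - v 2) * (v 4 - v 3) * (v 6 - v 5))
    = ((v 1 - v 0) * (u 1 - u 0) * (v 4 - v 3) * (u 4 - u 3))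
      * ((u 3 - u 2) * (v 3 - v 2) * (u 6 - u 5) * (v 6 - v 5))"
    by (simp add: mult_ac)
  also have "\<dots> \<le> ((u 2 - u 1) * (u 3 - u 0) * (u 5 - u 4) * (u 6 - u 3))
      * ((v 2 - v 1) * (v 3 - v 0) * (v 5 - v 4) * (v 6 - v 3))"
    using u v uv by (intro mult_mono mult_nonneg_nonneg) auto
  also have "\<dots> < ((u 1 - u 0) * (u 3 - u 2) * (u 4 - u 3) * (u 6 - u 5))
      * ((v 1 - v 0) * (v 3 - v 2) * (v 4 - v 3) * (v 6 - v 5))"
    using u v by (intro mult_strict_mono[OF wu wv] mult_pos_pos mult_nonneg_nonneg) auto
  finally show False by simp
qed

section \<open>The graph\<close>

text \<open>The neighbours of each vertex to its right. For \<open>u\<close> and \<open>v\<close> the slopes from vertex 7 to the left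
  wall \<open>0..6\<close> and the right wall \<open>8..14\<close>, the edges across the valley encode the order
  \<open>u0 u1 v0 v1 u2 u3 v2 u4 v3 v4 u5 u6 v5 v6\<close>.\<close>

definition right_neighbours :: "nat list list" where
  "right_neighbours =
    [[1, 3, 4, 5, 6, 7, 8, 9, 10, 11, 12, 13, 14],
     [2, 3, 6, 7, 8, 9, 10, 11, 12, 13, 14],
     [3, 6, 7, 10, 11, 12, 13, 14],
     [4, 5, 6, 7, 10, 11, 12, 13, 14],
     [5, 7, 11, 12, 13, 14],
     [6, 7, 13, 14],
     [7, 13, 14],
     [8, 9, 10, 11, 12, 13, 14],
     [9, 11, 12, 13, 14],
     [10, 11, 14],
     [11, 14],
     [12, 13, 14],
     [13],
     [14],
     []]"

definition arc :: "nat \<Rightarrow> nat \<Rightarrow> bool" where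
  "arc i j \<longleftrightarrow> i \<in> set [0..<15] \<and> j \<in> set (right_neighbours ! i)"

definition valley :: "nat \<Rightarrow> nat \<Rightarrow> bool" where
  "valley i j \<longleftrightarrow> arc i j \<or> arc j i"

lemma arcs_ascending: "\<forall>i\<in>set [0..<15]. \<forall>j\<in>set (right_neighbours ! i). i < j \<and> j < 15"
  by code_simp

text \<open>The X-property with all quantifiers over lists, so that evaluation decides it.\<close>

lemma arcs_crossing:
  "\<forall>a\<in>set [0..<15]. \<forall>c\<in>set (right_neighbours ! a). \<forall>b\<in>set [Suc a..<c].
    \<forall>d\<in>set (right_neighbours ! b). c < d \<longrightarrow> d \<in> set (right_neighbours ! a)"
  by code_simp

text \<open>The Bar-property in the same form; \<open>i < j < k\<close> is implied because arcs
  ascend.\<close>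

lemma arcs_triangle:
  "\<forall>i\<in>set [0..<15]. \<forall>k\<in>set (right_neighbours ! i). i + 2 \<le> k \<longrightarrow>
    (\<exists>j\<in>set (right_neighbours ! i). k \<in> set (right_neighbours ! j))"
  by code_simp

lemma arcs_path: "\<forall>i\<in>set [0..<14]. Suc i \<in> set (right_neighbours ! i)"
  by code_simp

lemma arc_less: "arc i j \<Longrightarrow> i < j \<and> j < 15"
  using arcs_ascending unfolding arc_def by blast

lemma valley_eq_arc: "i < j \<Longrightarrow> valley i j \<longleftrightarrow> arc i j"
  using arc_less[of j i] by (auto simp: valley_def)

lemma valley_is_graph: "is_graph 15 valley"
  unfolding is_graph_def valley_def using arc_less by (meson less_irrefl less_trans)

lemma valley_path: "i + 1 < 15 \<Longrightarrow> valley i (i + 1)"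
  using bspec[OF arcs_path, of i] by (simp add: valley_def arc_def)

lemma valley_persistent: "persistent 15 valley"
  unfolding persistent_def
proof
  show "X_property 15 valley"
    unfolding X_property_def
  proof (intro allI impI, elim conjE)
    fix a b c d :: nat
    assume "a < b" "b < c" "c < d" "d < 15" "valley a c" "valley b d"
    moreover from this have "arc a c" "arc b d"
      using valley_eq_arc by auto
    moreover have "b \<in> set [Suc a..<c]"
      using \<open>a < b\<close> \<open>b < c\<close> by simp
    ultimately show "valley a d"
      using arcs_crossing unfolding valley_def arc_def by blast
  qed
  show "Bar_property 15 valley"
    unfolding Bar_property_def
  proof (intro allI impI, elim conjE)
    fix i k :: nat
    assume ik: "i + 2 \<le> k" "k < 15" "valley i k"
    then have "arc i k"
      using valley_eq_arc by simp
    with ik obtain j where j: "j \<in> set (right_neighbours ! i)" "k \<in> set (right_neighbours ! j)"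
      using arcs_triangle unfolding arc_def by blast
    with \<open>arc i k\<close> have "arc i j"
      by (simp add: arc_def)
    then have "arc j k"
      using j arc_less[of i j] by (simp add: arc_def)
    with \<open>arc i j\<close> show "\<exists>j. i < j \<and> j < k \<and> valley i j \<and> valley j k"
      using arc_less by (auto simp: valley_def)
  qed
qed

lemma valley_not_terrain:
  assumes "is_terrain 15 p" "is_visibility_graph 15 p valley"
  shows False
proof -
  interpret terrain_drawing 15 p valley
    using assms by unfold_locales
  define u e where "u i = slope_from (p 7) (p i)" and "e i = nearness (p 7) (p i)" for i
  \<comment> \<open>The shift by 8 gives both walls the indices 0 to 6.\<close>
  define v f where "v i = u (8 + i)" and "f i = e (8 + i)" for i
  have above: "\<not> below px py i j k"
    if "i < k" "k < j" "j < 15" "\<not> valley i j" "valley i k" "valley k j" for i j k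
    using common_neighbour_blocks that by blast
  have uu: "u i < u k" if "i < k" "k < 7" for i k
  proof -
    have "valley i 7"
      using that by (auto simp: valley_def arc_def right_neighbours_def less_Suc_eq numeral_eq_Suc)
    then show ?thesis
      using edge_below[of i 7 k] that px_less
      by (simp add: u_def slope_from_left_less_iff)
  qed
  have vv: "v k < v j" if "k < j" "j < 7" for k j
  proof -
    have "valley 7 (8 + j)"
      using that by (auto simp: valley_def arc_def right_neighbours_def less_Suc_eq numeral_eq_Suc)
    then show ?thesis
      using edge_below[of 7 "8 + j" "8 + k"] that px_less
      by (simp add: u_def v_def slope_from_right_less_iff)
  qed
  \<comment> \<open>Both ends see vertex 7, so 7 alone decides whether they see each other.\<close>
  have across: "u i < v j \<longleftrightarrow> valley i (8 + j)" if "i < 7" "j < 7" for i j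
  proof -
    have "valley i 7" "valley 7 (8 + j)"
      using that by (auto simp: valley_def arc_def right_neighbours_def less_Suc_eq numeral_eq_Suc)
    then show ?thesis
      using edge_below[of i "8 + j" 7] above[of i 7 "8 + j"] that px_less
      by (auto simp: u_def v_def slope_from_across_less_iff)
  qed
  have left: "below u e i j k \<longleftrightarrow> below px py i j k" if "i < 7" "j < 7" "k < 7" for i j k
    using below_projective[of p i "p 7" j k] px_less that by (simp add: u_def[abs_def] e_def[abs_def])
  have right: "below v f i j k \<longleftrightarrow> below px py (8 + i) (8 + j) (8 + k)"
    if "i < 7" "j < 7" "k < 7" for i j k
    using below_projective[of p "8 + i" "p 7" "8 + j" "8 + k"] px_less that
    by (simp add: u_def e_def v_def f_def below_def)
  have valley_simps: "valley i j \<longleftrightarrow> (i < 15 \<and> j \<in> set (right_neighbours ! i)) \<or>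
    (j < 15 \<and> i \<in> set (right_neighbours ! j))" for i j
    by (simp add: valley_def arc_def)
  \<comment> \<open>The wall has the edges 0-4, 2-6, 0-3; the missing edges 0-2, 4-6, 1-5 are
    blocked by 1, 5, 3.\<close>
  have wu: "(u 2 - u 1) * (u 3 - u 0) * (u 5 - u 4) * (u 6 - u 3)
      < (u 1 - u 0) * (u 3 - u 2) * (u 4 - u 3) * (u 6 - u 5)"
    by (rule wall_inequality[of u e])
      (simp_all add: uu left above edge_below valley_simps right_neighbours_def)
  have wv: "(v 2 - v 1) * (v 3 - v 0) * (v 5 - v 4) * (v 6 - v 3)
      < (v 1 - v 0) * (v 3 - v 2) * (v 4 - v 3) * (v 6 - v 5)"
    by (rule wall_inequality[of v f])
      (simp_all add: vv right above edge_below valley_simps right_neighbours_def)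
  \<comment> \<open>These come from the edges 1-8, 3-10, 4-11, 6-13 and the non-edges 2-9,
    5-12.\<close>
  have order: "u 1 \<le> v 0" "v 1 \<le> u 2" "u 3 \<le> v 2" "u 4 \<le> v 3" "v 4 \<le> u 5" "u 6 \<le> v 5"
    using across[of 1 0] across[of 2 1] across[of 3 2] across[of 4 3] across[of 5 4] across[of 6 5]
    by (simp_all add: valley_simps right_neighbours_def)
  show False
    \<comment> \<open>The index 1 must not become \<open>Suc 0\<close>, or \<open>order\<close>
      would no longer match.\<close>
    by (rule interleaved_walls_contradiction[OF wu wv])
      (simp_all add: uu vv order del: One_nat_def)
qed

theorem theorem1:
  shows "\<exists>(n::nat) (E::nat \<Rightarrow> nat \<Rightarrow> bool).
           is_graph n E \<and> (\<forall>i. i + 1 < n \<longrightarrow> E i (i + 1)) \<and> persistent n E \<and>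
           \<not> (\<exists>p. is_terrain n p \<and> is_visibility_graph n p E)"
  using valley_is_graph valley_path valley_persistent valley_not_terrain by blast

end
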